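(* Let $R=\mathbb{K}[x_1,\dots,x_n]$ be a polynomial ring in $n$ variables over a field $\mathbb{K}$, let $\mathbf{a}\in\mathbb{N}^n$, and let $I$ be an $\mathbf{a}$-determined monomial ideal of $R$ generated in the same degree $d$. If $I$ is stable with $d=2$, or $I$ is strongly stable, then the $\mathbf{a}$-dual $\widehat{I}^{[\mathbf{a}]}$ has linear quotients. In particular, $\widehat{I}^{[\mathbf{a}]}$ has a linear resolution.
   Context: For a monomial ideal $I$, $G(I)$ denotes its minimal set of monomial generators; "generated in the same degree $d$" means all elements of $G(I)$ have degree $d$. For $\mathbf{a}\in\mathbb{N}^n$ (with $0\in\mathbb{N}$), write $\mathbf{x}^{\mathbf{a}}=\prod_k x_k^{\mathbf{a}(k)}$. The ideal $I$ is $\mathbf{a}$-determined if every $f\in G(I)$ divides $\mathbf{x}^{\mathbf{a}}$. In that case its $\mathbf{a}$-dual is the monomial ideal $\widehat{I}^{[\mathbf{a}]}$ with $G(\widehat{I}^{[\mathbf{a}]})=\{\mathbf{x}^{\mathbf{a}}/f \mid f\in G(I)\}$. For a monomial $m$, $\max(m)$ is the largest index $i$ such that $x_i$ divides $m$. A monomial ideal $I$ is stable if for each monomial $m\in I$ and each $i<\max(m)$ one has $mx_i/x_{\max(m)}\in I$. It is strongly stable if for each monomial $m\in I$, each $x_i$ dividing $m$ and each $j<i$, one has $mx_j/x_i\in I$. A monomial ideal has linear quotients if its minimal monomial generators can be ordered $g_1,\dots,g_\nu$ so that each colon ideal $(g_1,\dots,g_{k-1}):g_k$, $2\le k\le\nu$,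 is generated by a set of variables. *)

theory Defs
  imports "HOL-Library.Poly_Mapping" "Jordan_Normal_Form.Matrix_Kernel"
begin

section \<open>Polynomials and monomials\<close>

text \<open>
  The finite linearly ordered type \<open>'n\<close> plays the role of the index set \<open>{1 < \<dots> < n}\<close>,
  so that \<open>('n, 'k) mpoly\<close> is the polynomial ring in \<open>n = CARD('n)\<close> ordered variables over \<open>'k\<close>.
  A monomial is represented by its exponent vector. Beware that the library's order \<open>\<le>\<close> on
  exponent vectors is lexicographic; divisibility is \<open>dvd\<close> in the polynomial ring.
\<close>

type_synonym 'n exponent = "'n \<Rightarrow>\<^sub>0 nat"

type_synonym ('n, 'k) mpoly = "('n \<Rightarrow>\<^sub>0 nat) \<Rightarrow>\<^sub>0 'k"

definition monomial :: "'n exponent \<Rightarrow> ('n, 'k::comm_ring_1) mpoly" where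
  "monomial m = Poly_Mapping.single m 1"

definition var :: "'n \<Rightarrow> ('n, 'k::comm_ring_1) mpoly" where
  "var i = monomial (Poly_Mapping.single i 1)"

definition mdeg :: "'n::finite exponent \<Rightarrow> nat" where
  "mdeg m = (\<Sum>i\<in>UNIV. Poly_Mapping.lookup m i)"

abbreviation is_ideal :: "'a::comm_ring_1 set \<Rightarrow> bool" where
  "is_ideal \<equiv> Modules.module.subspace (*)"

abbreviation ideal_gen :: "'a::comm_ring_1 set \<Rightarrow> 'a set" where
  "ideal_gen \<equiv> Modules.module.span (*)"

definition colon_ideal :: "'a::comm_ring_1 set \<Rightarrow> 'a \<Rightarrow> 'a set" where
  "colon_ideal J f = {p. p * f \<in> J}"


section \<open>Monomial ideals and the dual\<close>

definition monomial_ideal :: "('n, 'k::comm_ring_1) mpoly set \<Rightarrow> bool" where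
  "monomial_ideal I \<longleftrightarrow> (\<exists>S. I = ideal_gen (monomial ` S))"

definition is_min_gens :: "'n exponent set \<Rightarrow> ('n, 'k::comm_ring_1) mpoly set \<Rightarrow> bool" where
  "is_min_gens S I \<longleftrightarrow>
     ideal_gen (monomial ` S) = I \<and> (\<forall>T. T \<subset> S \<longrightarrow> ideal_gen (monomial ` T) \<noteq> I)"

text \<open>Well defined for monomial ideals, see \<open>min_gens_ex1\<close> below.\<close>

definition min_gens :: "('n, 'k::comm_ring_1) mpoly set \<Rightarrow> 'n exponent set" where
  "min_gens I = (THE S. is_min_gens S I)"

definition generated_in_degree :: "nat \<Rightarrow> ('n::finite, 'k::comm_ring_1) mpoly set \<Rightarrow> bool" where
  "generated_in_degree d I \<longleftrightarrow> (\<forall>m\<in>min_gens I. mdeg m = d)"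

definition determined :: "'n exponent \<Rightarrow> ('n, 'k::comm_ring_1) mpoly set \<Rightarrow> bool" where
  "determined a I \<longleftrightarrow> (\<forall>m\<in>min_gens I. (monomial m :: ('n, 'k) mpoly) dvd monomial a)"

text \<open>
  Only meaningful if \<open>determined a I\<close>, because subtraction of exponents truncates. In that case
  the generators below are the minimal ones, see \<open>min_gens_dual\<close>.
\<close>

definition dual_ideal :: "'n exponent \<Rightarrow> ('n, 'k::comm_ring_1) mpoly set \<Rightarrow> ('n, 'k) mpoly set" where
  "dual_ideal a I = ideal_gen (monomial ` {a - m | m. m \<in> min_gens I})"


section \<open>Stability\<close>

text \<open>
  The largest index of a variable dividing the monomial, that is, the largest \<open>i\<close> with nonzero
  exponent; used for monomials other than 1 only.
\<close>

definition max_index :: "'n::linorder exponent \<Rightarrow> 'n" where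
  "max_index m = Max (Poly_Mapping.keys m)"

text \<open>The exponent vector of \<open>m x\<^sub>j / x\<^sub>i\<close>, for \<open>x\<^sub>i\<close> dividing \<open>m\<close>.\<close>

definition exchange :: "'n exponent \<Rightarrow> 'n \<Rightarrow> 'n \<Rightarrow> 'n exponent" where
  "exchange m j i = (m - Poly_Mapping.single i 1) + Poly_Mapping.single j 1"

definition stable_ideal :: "('n::linorder, 'k::comm_ring_1) mpoly set \<Rightarrow> bool" where
  "stable_ideal I \<longleftrightarrow>
     (\<forall>m. monomial m \<in> I \<and> m \<noteq> 0 \<longrightarrow>
        (\<forall>i < max_index m. monomial (exchange m i (max_index m)) \<in> I))"

definition strongly_stable_ideal :: "('n::linorder, 'k::comm_ring_1) mpoly set \<Rightarrow> bool" where
  "strongly_stable_ideal I \<longleftrightarrow>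
     (\<forall>m. monomial m \<in> I \<longrightarrow>
        (\<forall>i\<in>Poly_Mapping.keys m. \<forall>j < i. monomial (exchange m j i) \<in> I))"


section \<open>Linear quotients and linear resolutions\<close>

definition has_linear_quotients :: "('n, 'k::comm_ring_1) mpoly set \<Rightarrow> bool" where
  "has_linear_quotients I \<longleftrightarrow>
     (\<exists>gs. distinct gs \<and> set gs = min_gens I \<and>
        (\<forall>k. 1 \<le> k \<and> k < length gs \<longrightarrow>
           (\<exists>V. colon_ideal (ideal_gen (monomial ` set (take k gs))) (monomial (gs ! k))
                 = (ideal_gen (var ` V) :: ('n, 'k) mpoly set))))"

text \<open>
  A complex \<open>\<dots> \<rightarrow> F\<^sub>1 \<rightarrow> F\<^sub>0 \<rightarrow> I \<rightarrow> 0\<close> is given by matrices: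
  \<open>F\<^sub>i\<close> is the free module of rank \<open>b i\<close> whose \<open>j\<close>-th basis element has degree \<open>s i j\<close>,
  that is \<open>F\<^sub>i = \<Oplus>\<^sub>j R(-s i j)\<close>; the matrix \<open>D (Suc i)\<close> is the differential
  \<open>F\<^sub>i\<^sub>+\<^sub>1 \<rightarrow> F\<^sub>i\<close>, and the one-row matrix \<open>D 0\<close> is the augmentation \<open>F\<^sub>0 \<rightarrow> I \<subseteq> R\<close>.
  All maps are homogeneous of degree 0: a nonzero entry in row \<open>r\<close> and column \<open>c\<close> is homogeneous
  and its degree is the degree of the \<open>c\<close>-th basis element of the source minus that of the
  \<open>r\<close>-th basis element of the target (the basis element of \<open>R\<close> has degree 0).
\<close>

definition graded_free_resolution ::
  "(nat \<Rightarrow> nat) \<Rightarrow> (nat \<Rightarrow> nat \<Rightarrow> nat) \<Rightarrow> (nat \<Rightarrow> ('n::finite, 'k::comm_ring_1) mpoly mat)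
    \<Rightarrow> ('n, 'k) mpoly set \<Rightarrow> bool" where
  "graded_free_resolution b s D I \<longleftrightarrow>
     D 0 \<in> carrier_mat 1 (b 0) \<and>
     (\<forall>i. D (Suc i) \<in> carrier_mat (b i) (b (Suc i))) \<and>
     (\<forall>c<b 0. \<forall>t\<in>Poly_Mapping.keys (D 0 $$ (0, c)). mdeg t = s 0 c) \<and>
     (\<forall>i. \<forall>r<b i. \<forall>c<b (Suc i). \<forall>t\<in>Poly_Mapping.keys (D (Suc i) $$ (r, c)).
        mdeg t + s i r = s (Suc i) c) \<and>
     (\<lambda>v. (D 0 *\<^sub>v v) $ 0) ` carrier_vec (b 0) = I \<and>
     (\<forall>i. (\<lambda>v. D (Suc i) *\<^sub>v v) ` carrier_vec (b (Suc i)) = mat_kernel (D i))"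

text \<open>Minimality: the image of \<open>F\<^sub>i\<^sub>+\<^sub>1\<close> lies in \<open>(x\<^sub>1, \<dots>, x\<^sub>n) F\<^sub>i\<close>.\<close>

definition minimal_graded_free_resolution ::
  "(nat \<Rightarrow> nat) \<Rightarrow> (nat \<Rightarrow> nat \<Rightarrow> nat) \<Rightarrow> (nat \<Rightarrow> ('n::finite, 'k::comm_ring_1) mpoly mat)
    \<Rightarrow> ('n, 'k) mpoly set \<Rightarrow> bool" where
  "minimal_graded_free_resolution b s D I \<longleftrightarrow>
     graded_free_resolution b s D I \<and>
     (\<forall>i. \<forall>r<b i. \<forall>c<b (Suc i). D (Suc i) $$ (r, c) \<in> ideal_gen (var ` UNIV))"

text \<open>The minimal resolution has the form \<open>F\<^sub>i = R(-d-i)\<^bsup>b i\<^esup>\<close> for some \<open>d\<close>.\<close>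

definition has_linear_resolution :: "('n::finite, 'k::comm_ring_1) mpoly set \<Rightarrow> bool" where
  "has_linear_resolution I \<longleftrightarrow>
     (\<exists>d b s D. minimal_graded_free_resolution b s D I \<and> (\<forall>i. \<forall>j<b i. s i j = d + i))"


section \<open>Well-definedness\<close>

lemma module_ring: "Modules.module ((*) :: 'a::comm_ring_1 \<Rightarrow> 'a \<Rightarrow> 'a)"
  by unfold_locales (auto simp: algebra_simps)

lemma in_ideal_gen_monomials:
  fixes p :: "('n, 'k::comm_ring_1) mpoly"
  shows "p \<in> ideal_gen (monomial ` S) \<longleftrightarrow>
    (\<forall>t\<in>Poly_Mapping.keys p. \<exists>s\<in>S. \<exists>u. t = s + u)" (is "_ \<longleftrightarrow> ?P p")
proof
  let ?J = "{p :: ('n, 'k) mpoly. ?P p}"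
  have sub: "is_ideal ?J"
    unfolding Modules.module.subspace_def[OF module_ring]
  proof (safe, goal_cases)
    case (1 t) then show ?case by simp
  next
    case (2 x y t)
    then show ?case using keys_add[of x y] by blast
  next
    case (3 c x t)
    then obtain v w where "t = v + w" "w \<in> Poly_Mapping.keys x"
      using keys_mult[of c x] by blast
    moreover then obtain s u where "s \<in> S" "w = s + u" using 3 by blast
    ultimately have "t = s + (u + v)" by (simp add: ac_simps)
    with \<open>s \<in> S\<close> show ?case by blast
  qed
  have "?P (monomial m)" if "m \<in> S" for m
  proof
    fix t assume "t \<in> Poly_Mapping.keys (monomial m :: ('n, 'k) mpoly)"
    then have "t = m + 0" by (simp add: monomial_def)
    with that show "\<exists>s\<in>S. \<exists>u. t = s + u" by blast
  qed
  then have "monomial ` S \<subseteq> ?J" by blast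
  then have "ideal_gen (monomial ` S) \<subseteq> ?J"
    using Modules.module.span_minimal[OF module_ring _ sub] by blast
  then show "p \<in> ideal_gen (monomial ` S) \<Longrightarrow> ?P p" by blast
next
  assume P: "?P p"
  have "p = (\<Sum>t\<in>Poly_Mapping.keys p. Poly_Mapping.single t (Poly_Mapping.lookup p t))"
    by (rule poly_mapping_eqI)
      (simp add: lookup_sum lookup_single when_def in_keys_iff)
  also have "\<dots> \<in> ideal_gen (monomial ` S)"
  proof (rule Modules.module.span_sum[OF module_ring])
    fix t assume "t \<in> Poly_Mapping.keys p"
    then obtain s u where su: "s \<in> S" "t = s + u" using P by blast
    then have "Poly_Mapping.single t (Poly_Mapping.lookup p t)
        = Poly_Mapping.single u (Poly_Mapping.lookup p t) * (monomial s :: ('n, 'k) mpoly)"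
      by (simp add: monomial_def mult_single add.commute)
    also have "\<dots> \<in> ideal_gen (monomial ` S)"
      using su by (intro Modules.module.span_scale[OF module_ring] Modules.module.span_base[OF module_ring]) auto
    finally show "Poly_Mapping.single t (Poly_Mapping.lookup p t) \<in> ideal_gen (monomial ` S)" .
  qed
  finally show "p \<in> ideal_gen (monomial ` S)" .
qed

lemma monomial_in_ideal_gen:
  "(monomial t :: ('n, 'k::comm_ring_1) mpoly) \<in> ideal_gen (monomial ` S) \<longleftrightarrow> (\<exists>s\<in>S. \<exists>u. t = s + u)"
  by (simp add: in_ideal_gen_monomials) (simp add: monomial_def)

lemma monomial_dvd_iff:
  "(monomial s :: ('n, 'k::comm_ring_1) mpoly) dvd monomial t \<longleftrightarrow> (\<exists>u. t = s + u)"
proof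
  assume "(monomial s :: ('n, 'k) mpoly) dvd monomial t"
  then obtain q where "(monomial t :: ('n, 'k) mpoly) = monomial s * q" ..
  then have "(monomial t :: ('n, 'k) mpoly) = q * monomial s" by (simp only: mult.commute)
  also have "\<dots> \<in> ideal_gen (monomial ` {s})"
    by (intro Modules.module.span_scale[OF module_ring] Modules.module.span_base[OF module_ring]) simp
  finally have "(monomial t :: ('n, 'k) mpoly) \<in> ideal_gen (monomial ` {s})" .
  then show "\<exists>u. t = s + u" by (simp only: monomial_in_ideal_gen) blast
next
  assume "\<exists>u. t = s + u"
  then obtain u where "t = s + u" by blast
  then have "(monomial t :: ('n, 'k) mpoly) = monomial s * monomial u" by (simp add: monomial_def mult_single)
  then show "(monomial s :: ('n, 'k) mpoly) dvd monomial t" by simp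
qed

lemma exponent_add_zero:
  fixes s :: "'n exponent"
  assumes "s = s + u + v"
  shows "u = 0" "v = 0"
proof -
  have "Poly_Mapping.lookup u i = 0 \<and> Poly_Mapping.lookup v i = 0" for i
    using arg_cong[OF assms, of "\<lambda>m. Poly_Mapping.lookup m i"] by (simp add: lookup_add)
  then show "u = 0" "v = 0" by (auto intro: poly_mapping_eqI)
qed

lemma is_min_gens_antichain:
  assumes "is_min_gens S (I :: ('n, 'k::comm_ring_1) mpoly set)" "s \<in> S" "s + u \<in> S"
  shows "u = 0"
proof (rule ccontr)
  assume "u \<noteq> 0"
  then have ne: "s \<noteq> s + u" using exponent_add_zero(1)[of s u 0] by auto
  have "\<exists>r\<in>S - {s + u}. \<exists>v. t = r + v" if "r \<in> S" "t = r + v" for t r v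
  proof (cases "r = s + u")
    case True
    then have "t = s + (u + v)" using that by (simp add: add.assoc)
    then show ?thesis using assms(2) ne by blast
  qed (use that in blast)
  then have "ideal_gen (monomial ` (S - {s + u})) = (ideal_gen (monomial ` S) :: ('n, 'k) mpoly set)"
    unfolding set_eq_iff in_ideal_gen_monomials by (metis Diff_iff)
  then show False using assms unfolding is_min_gens_def by blast
qed

lemma is_min_gensI:
  assumes "\<And>s u. s \<in> S \<Longrightarrow> s + u \<in> S \<Longrightarrow> u = 0"
  shows "is_min_gens S (ideal_gen (monomial ` S) :: ('n, 'k::comm_ring_1) mpoly set)"
  unfolding is_min_gens_def
proof (intro conjI allI impI notI)
  fix T assume "T \<subset> S" and eq: "ideal_gen (monomial ` T) = (ideal_gen (monomial ` S) :: ('n, 'k) mpoly set)"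
  then obtain s where s: "s \<in> S" "s \<notin> T" by blast
  then have "(monomial s :: ('n, 'k) mpoly) \<in> ideal_gen (monomial ` T)"
    unfolding eq by (intro Modules.module.span_base[OF module_ring]) auto
  then obtain t u where "t \<in> T" "s = t + u" unfolding monomial_in_ideal_gen by blast
  moreover have "u = 0" using calculation s \<open>T \<subset> S\<close> by (intro assms[of t]) auto
  ultimately show False using s by simp
qed simp

lemma is_min_gens_unique:
  assumes "is_min_gens S I" "is_min_gens T (I :: ('n, 'k::comm_ring_1) mpoly set)"
  shows "S = T"
proof -
  have "A \<subseteq> B" if A: "is_min_gens A I" and B: "is_min_gens B I" for A B
  proof
    have eq: "ideal_gen (monomial ` A) = (ideal_gen (monomial ` B) :: ('n, 'k) mpoly set)"
      using A B unfolding is_min_gens_def by simp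
    fix s assume s: "s \<in> A"
    then have "(monomial s :: ('n, 'k) mpoly) \<in> ideal_gen (monomial ` A)"
      by (intro Modules.module.span_base[OF module_ring]) auto
    then obtain t u where t: "t \<in> B" "s = t + u"
      unfolding eq monomial_in_ideal_gen by blast
    then have "(monomial t :: ('n, 'k) mpoly) \<in> ideal_gen (monomial ` B)"
      by (intro Modules.module.span_base[OF module_ring]) auto
    then obtain r v where r: "r \<in> A" "t = r + v"
      unfolding eq[symmetric] monomial_in_ideal_gen by blast
    have "v + u = 0" using is_min_gens_antichain[OF A, of r "v + u"] r t s by (simp add: add.assoc)
    then have "u = 0" using exponent_add_zero[of 0 v u] by simp
    with t show "s \<in> B" by simp
  qed
  with assms show ?thesis by blast
qed

lemma min_gens_eqI: "is_min_gens S I \<Longrightarrow> min_gens I = S"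
  unfolding min_gens_def by (rule the_equality) (simp, rule is_min_gens_unique)

lemma min_gens_ex1:
  assumes "monomial_ideal (I :: ('n::finite, 'k::comm_ring_1) mpoly set)"
  shows "\<exists>!S. is_min_gens S I"
proof -
  obtain S where S: "I = ideal_gen (monomial ` S)" using assms unfolding monomial_ideal_def by blast
  define T where "T = {s \<in> S. \<forall>r\<in>S. \<forall>u. s = r + u \<longrightarrow> u = 0}"
  have deg_add: "mdeg (r + u) = mdeg r + mdeg u" for r u :: "'n exponent"
    by (simp add: mdeg_def lookup_add sum.distrib)
  have deg_0: "mdeg u = 0 \<Longrightarrow> u = 0" for u :: "'n exponent"
    by (rule poly_mapping_eqI) (simp add: mdeg_def)
  have below: "\<exists>t\<in>T. \<exists>u. s = t + u" if "s \<in> S" for s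
    using that
  proof (induction "mdeg s" arbitrary: s rule: less_induct)
    case less
    show ?case
    proof (cases "s \<in> T")
      case True then show ?thesis by (intro bexI[of _ s] exI[of _ 0]) simp_all
    next
      case False
      then have "\<not> (\<forall>r\<in>S. \<forall>u. s = r + u \<longrightarrow> u = 0)"
        using less.prems unfolding T_def by simp
      then obtain r u where r: "r \<in> S" "s = r + u" "u \<noteq> 0"
        by blast
      have "mdeg u \<noteq> 0" using deg_0 r(3) by blast
      then have "mdeg r < mdeg s" unfolding r(2) deg_add by simp
      then obtain t v where "t \<in> T" "r = t + v" using less.hyps[OF _ r(1)] by blast
      then have "s = t + (v + u)" using r by (simp add: add.assoc)
      with \<open>t \<in> T\<close> show ?thesis by blast
    qed
  qed
  have "T \<subseteq> S" by (auto simp: T_def)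
  have "(\<exists>s\<in>S. \<exists>u. t = s + u) \<longleftrightarrow> (\<exists>s\<in>T. \<exists>u. t = s + u)" for t
  proof
    assume "\<exists>s\<in>S. \<exists>u. t = s + u"
    then obtain s u where "s \<in> S" "t = s + u" by blast
    moreover then obtain r v where "r \<in> T" "s = r + v" using below by blast
    ultimately have "t = r + (v + u)" by (simp add: add.assoc)
    with \<open>r \<in> T\<close> show "\<exists>s\<in>T. \<exists>u. t = s + u" by blast
  qed (use \<open>T \<subseteq> S\<close> in blast)
  then have "I = ideal_gen (monomial ` T)" unfolding S set_eq_iff in_ideal_gen_monomials by simp
  moreover have "is_min_gens T (ideal_gen (monomial ` T) :: ('n, 'k) mpoly set)"
  proof (rule is_min_gensI)
    fix s u assume "s \<in> T" "s + u \<in> T"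
    then have "s \<in> S" "\<And>r v. r \<in> S \<Longrightarrow> s + u = r + v \<Longrightarrow> v = 0" unfolding T_def by simp_all
    from this(2)[OF this(1) refl] show "u = 0" .
  qed
  ultimately have "is_min_gens T I" by (simp only:)
  show ?thesis
  proof (rule ex1I)
    show "is_min_gens T I" by fact
    fix S' assume "is_min_gens S' I"
    from this \<open>is_min_gens T I\<close> show "S' = T" by (rule is_min_gens_unique)
  qed
qed

lemma min_gens_dual:
  fixes I :: "('n::finite, 'k::comm_ring_1) mpoly set"
  assumes "monomial_ideal I" "determined a I"
  shows "min_gens (dual_ideal a I) = {a - m | m. m \<in> min_gens I}"
proof -
  have min: "is_min_gens (min_gens I) I"
    unfolding min_gens_def by (rule theI'[OF min_gens_ex1[OF assms(1)]])
  have le: "Poly_Mapping.lookup m i \<le> Poly_Mapping.lookup a i" if m: "m \<in> min_gens I" for m i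
  proof -
    obtain u where "a = m + u" using assms(2) m unfolding determined_def monomial_dvd_iff by blast
    then show ?thesis by (simp add: lookup_add)
  qed
  have "u = 0" if "m \<in> min_gens I" "r \<in> min_gens I" "a - m + u = a - r" for m r u
  proof -
    have "m = r + u"
    proof (rule poly_mapping_eqI)
      fix i show "Poly_Mapping.lookup m i = Poly_Mapping.lookup (r + u) i"
        using arg_cong[OF that(3), of "\<lambda>m. Poly_Mapping.lookup m i"] le[OF that(1), of i] le[OF that(2), of i]
        by (simp add: lookup_add lookup_minus)
    qed
    then show "u = 0" using is_min_gens_antichain[OF min, of r u] that by simp
  qed
  then have "is_min_gens {a - m | m. m \<in> min_gens I} (dual_ideal a I)"
    unfolding dual_ideal_def by (intro is_min_gensI) auto
  then show ?thesis by (rule min_gens_eqI)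
qed

end

theory Submission
  imports Defs
begin

text \<open>
  List \<open>G(I)\<close> in decreasing lexicographic order. If \<open>m'\<close> comes before \<open>m\<close>, then (strong) stability
  produces an earlier generator \<open>m x\<^sub>j / x\<^sub>i\<close> for some \<open>x\<^sub>i\<close> whose exponent in \<open>m\<close> exceeds that in
  \<open>m'\<close>. On the dual side \<open>x\<^sub>i\<close> then lies in the colon ideal of \<open>x\<^sup>a / m\<close> and divides the generator
  contributed by \<open>x\<^sup>a / m'\<close>, so all colon ideals are generated by variables.

  Linear quotients in a single degree \<open>e\<close> yield a linear resolution by iterated mapping cones: if \<open>J\<close>
  has a linear resolution in degree \<open>e\<close>, \<open>J : g\<close> has one in degree 1 and \<open>g\<close> is homogeneous of degree
  \<open>e\<close>, then \<open>J + (g)\<close> has one in degree \<open>e\<close>. The same step with \<open>e = 1\<close> resolves ideals of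
  variables, because \<open>(x\<^sub>i | i \<in> V) : x\<^sub>j = (x\<^sub>i | i \<in> V)\<close> for \<open>j \<notin> V\<close>. The shape of the degrees makes
  all these resolutions minimal.
\<close>

section \<open>Colon ideals and exponents\<close>

text \<open>Multiplication by a monomial shifts exponents injectively, so no two terms collide and
  every coefficient survives.\<close>

lemma keys_mult_monomial:
  fixes p :: "('n, 'k::comm_ring_1) mpoly"
  shows "Poly_Mapping.keys (p * monomial m) = (\<lambda>t. t + m) ` Poly_Mapping.keys p"
proof -
  have p: "p = (\<Sum>t\<in>Poly_Mapping.keys p. Poly_Mapping.single t (Poly_Mapping.lookup p t))"
    by (rule poly_mapping_eqI) (simp add: lookup_sum lookup_single when_def in_keys_iff)
  have "p * monomial m
      = (\<Sum>t\<in>Poly_Mapping.keys p. Poly_Mapping.single (t + m) (Poly_Mapping.lookup p t))"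
    by (subst p) (simp add: sum_distrib_right monomial_def mult_single)
  then have *: "Poly_Mapping.lookup (p * monomial m) (t + m) = Poly_Mapping.lookup p t" for t
    by (simp add: lookup_sum lookup_single when_def in_keys_iff)
  have "Poly_Mapping.keys (p * monomial m) \<subseteq> (\<lambda>t. t + m) ` Poly_Mapping.keys p"
    using keys_mult[of p "monomial m"] by (auto simp: monomial_def)
  then show ?thesis
    using * by (auto simp: in_keys_iff)
qed

lemma in_colon_ideal_monomial:
  fixes p :: "('n, 'k::comm_ring_1) mpoly"
  shows "p \<in> colon_ideal (ideal_gen (monomial ` S)) (monomial m) \<longleftrightarrow>
    (\<forall>t\<in>Poly_Mapping.keys p. \<exists>s\<in>S. \<exists>u. t + m = s + u)"
  by (simp add: colon_ideal_def in_ideal_gen_monomials keys_mult_monomial)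

lemma var_image: "var ` V = monomial ` (\<lambda>i. Poly_Mapping.single i 1) ` V"
  by (auto simp: var_def)

lemma in_ideal_gen_vars:
  fixes p :: "('n, 'k::comm_ring_1) mpoly"
  shows "p \<in> ideal_gen (var ` V) \<longleftrightarrow>
    (\<forall>t\<in>Poly_Mapping.keys p. \<exists>i\<in>V. \<exists>u. t = Poly_Mapping.single i 1 + u)"
  unfolding var_image in_ideal_gen_monomials by simp

lemma ex_eq_add_iff_lookup_le:
  fixes s t :: "'n exponent"
  shows "(\<exists>u. t = s + u) \<longleftrightarrow> (\<forall>i. Poly_Mapping.lookup s i \<le> Poly_Mapping.lookup t i)"
proof
  assume "\<forall>i. Poly_Mapping.lookup s i \<le> Poly_Mapping.lookup t i"
  then have "t = s + (t - s)"
    by (intro poly_mapping_eqI) (simp add: lookup_add lookup_minus)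
  then show "\<exists>u. t = s + u" ..
qed (auto simp: lookup_add)

lemma ex_eq_single_add_iff:
  fixes t :: "'n exponent"
  shows "(\<exists>u. t = Poly_Mapping.single i 1 + u) \<longleftrightarrow> Poly_Mapping.lookup t i \<noteq> 0"
  unfolding ex_eq_add_iff_lookup_le by (auto simp: lookup_single when_def)

lemma lookup_neq_0E:
  fixes t :: "'n exponent"
  assumes "Poly_Mapping.lookup t i \<noteq> 0"
  obtains u where "t = Poly_Mapping.single i 1 + u"
  using ex_eq_single_add_iff[THEN iffD2, OF assms] by (elim exE)

text \<open>If \<open>t + m\<close> is a multiple of \<open>s\<close> and the exponent of
  \<open>s\<close> at \<open>i\<close> exceeds that of \<open>m\<close>, then \<open>x_i\<close>
  divides \<open>t\<close>. The assumption supplies such an \<open>i\<close> for each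
  \<open>s\<close>, with \<open>x_i\<close> itself in the colon ideal, so every monomial of the
  colon ideal is a multiple of one of these variables.\<close>

lemma colon_ideal_eq_vars:
  fixes S :: "'n exponent set"
  assumes "\<And>s. s \<in> S \<Longrightarrow> \<exists>i r u. Poly_Mapping.lookup m i < Poly_Mapping.lookup s i \<and> r \<in> S \<and>
    Poly_Mapping.single i 1 + m = r + u"
  shows "colon_ideal (ideal_gen (monomial ` S)) (monomial m) =
    (ideal_gen (var ` {i. \<exists>r\<in>S. \<exists>u. Poly_Mapping.single i 1 + m = r + u})
      :: ('n, 'k::comm_ring_1) mpoly set)"
proof -
  have eqv: "(\<exists>s\<in>S. \<exists>u. t + m = s + u) \<longleftrightarrow>
    (\<exists>i\<in>{i. \<exists>r\<in>S. \<exists>u. Poly_Mapping.single i 1 + m = r + u}. \<exists>u. t = Poly_Mapping.single i 1 + u)"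
    (is "?L \<longleftrightarrow> ?R") for t
  proof
    assume ?L
    then obtain s v where s: "s \<in> S" "t + m = s + v" by blast
    obtain i r u where i: "Poly_Mapping.lookup m i < Poly_Mapping.lookup s i" "r \<in> S"
      "Poly_Mapping.single i 1 + m = r + u"
      using assms[OF s(1)] by blast
    have "Poly_Mapping.lookup t i + Poly_Mapping.lookup m i
        = Poly_Mapping.lookup s i + Poly_Mapping.lookup v i"
      using arg_cong[OF s(2), of "\<lambda>m. Poly_Mapping.lookup m i"] by (simp add: lookup_add)
    with i(1) have "Poly_Mapping.lookup t i \<noteq> 0" by simp
    with i(2,3) show ?R unfolding ex_eq_single_add_iff by blast
  next
    assume ?R
    then obtain i r u v where "r \<in> S" "Poly_Mapping.single i 1 + m = r + u"
      "t = Poly_Mapping.single i 1 + v" by blast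
    then have "t + m = r + (u + v)" by (metis add.assoc add.commute)
    with \<open>r \<in> S\<close> show ?L by blast
  qed
  show ?thesis
  proof (rule Set.set_eqI)
    fix p :: "('n, 'k) mpoly"
    show "p \<in> colon_ideal (ideal_gen (monomial ` S)) (monomial m) \<longleftrightarrow>
      p \<in> ideal_gen (var ` {i. \<exists>r\<in>S. \<exists>u. Poly_Mapping.single i 1 + m = r + u})"
      unfolding in_colon_ideal_monomial in_ideal_gen_vars by (rule ball_cong, rule refl, rule eqv)
  qed
qed

section \<open>Exchanges, degrees and the lexicographic order\<close>

lemma lookup_exchange:
  "Poly_Mapping.lookup (exchange m j i) k =
    Poly_Mapping.lookup m k - (if k = i then 1 else 0) + (if k = j then 1 else 0)"
  by (simp add: exchange_def lookup_add lookup_minus lookup_single when_def)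

lemma mdeg_0 [simp]: "mdeg 0 = 0"
  by (simp add: mdeg_def)

lemma mdeg_add: "mdeg (s + t) = mdeg s + mdeg t"
  by (simp add: mdeg_def lookup_add sum.distrib)

lemma mdeg_single [simp]: "mdeg (Poly_Mapping.single i c) = c"
  by (simp add: mdeg_def lookup_single when_def)

lemma mdeg_eq_0_iff: "mdeg m = 0 \<longleftrightarrow> m = 0"
proof
  assume "mdeg m = 0"
  then show "m = 0" by (intro poly_mapping_eqI) (simp add: mdeg_def)
qed simp

lemma mdeg_exchange:
  assumes "Poly_Mapping.lookup m i \<noteq> 0"
  shows "mdeg (exchange m j i) = mdeg m"
proof -
  obtain u where u: "m = Poly_Mapping.single i 1 + u"
    using assms by (rule lookup_neq_0E)
  show ?thesis unfolding u by (simp add: exchange_def mdeg_add)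
qed

text \<open>The lexicographic order is decided at the smallest index where the exponents differ.
  This is \<open>j\<close>: the exponent goes up there, and any loss occurs only at the larger index
  \<open>i\<close>.\<close>

lemma exchange_greater:
  assumes "j < i"
  shows "m < exchange m j i"
  unfolding less_poly_mapping.rep_eq less_fun_def
  using assms by (intro exI[of _ j]) (auto simp: lookup_exchange)

text \<open>Otherwise \<open>m\<close> divides \<open>m'\<close>, and equal degrees force the
  quotient to be 1.\<close>

lemma ex_lookup_less_if_mdeg_eq:
  assumes "mdeg m = mdeg m'" "m \<noteq> m'"
  shows "\<exists>i. Poly_Mapping.lookup m' i < Poly_Mapping.lookup m i"
proof (rule ccontr)
  assume "\<not> ?thesis"
  then have "\<exists>u. m' = m + u"
    unfolding ex_eq_add_iff_lookup_le by (simp add: not_less)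
  then obtain u where u: "m' = m + u" ..
  have "mdeg u = 0" using assms(1) unfolding u mdeg_add by simp
  then show False using assms(2) u by (simp add: mdeg_eq_0_iff)
qed

section \<open>Linear quotients of the dual\<close>

context
  fixes I :: "('n::{finite,linorder}, 'k::field) mpoly set" and d :: nat
  assumes mono: "monomial_ideal I" and gen: "generated_in_degree d I"
begin

lemma is_min_gens_min_gens: "is_min_gens (min_gens I) I"
  unfolding min_gens_def by (rule theI'[OF min_gens_ex1[OF mono]])

lemma monomial_in_iff: "monomial m \<in> I \<longleftrightarrow> (\<exists>s\<in>min_gens I. \<exists>u. m = s + u)"
  using is_min_gens_min_gens monomial_in_ideal_gen unfolding is_min_gens_def by blast

text \<open>A generator dividing a monomial of degree \<open>d\<close> in \<open>I\<close> has the
  same degree, hence equals it. Stability only places an exchanged monomial in \<open>I\<close>;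
  this places it in \<open>G(I)\<close>.\<close>

lemma in_min_gens_iff: "m \<in> min_gens I \<longleftrightarrow> monomial m \<in> I \<and> mdeg m = d"
proof
  assume "m \<in> min_gens I"
  then show "monomial m \<in> I \<and> mdeg m = d"
    using gen unfolding monomial_in_iff generated_in_degree_def
    by (metis add.right_neutral)
next
  assume *: "monomial m \<in> I \<and> mdeg m = d"
  then obtain s u where s: "s \<in> min_gens I" "m = s + u" unfolding monomial_in_iff by blast
  with gen * have "u = 0"
    by (auto simp: generated_in_degree_def mdeg_add mdeg_eq_0_iff)
  with s show "m \<in> min_gens I" by simp
qed

text \<open>
  In the strongly stable case any variable with larger exponent in \<open>m\<close> than in \<open>m'\<close> can be traded
  for the first variable where the exponents differ. In the stable case of degree 2 this works for
  the last variable of \<open>m\<close> if its exponent is larger in \<open>m\<close>; otherwise \<open>m\<close> and \<open>m'\<close> have that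
  variable in common, and \<open>m'\<close> itself arises from \<open>m\<close> by exchanging the other one.
\<close>

lemma exchange_in_min_gens:
  assumes st: "(stable_ideal I \<and> d = 2) \<or> strongly_stable_ideal I"
    and m: "m \<in> min_gens I" and m': "m' \<in> min_gens I" and less: "m < m'"
  shows "\<exists>i j. Poly_Mapping.lookup m' i < Poly_Mapping.lookup m i \<and> j \<noteq> i \<and>
    exchange m j i \<in> min_gens I \<and> m < exchange m j i"
proof -
  let ?l = Poly_Mapping.lookup
  have I: "monomial m \<in> I" "monomial m' \<in> I" and deg: "mdeg m = d" "mdeg m' = d"
    using m m' by (simp_all add: in_min_gens_iff)
  obtain p where p: "?l m p < ?l m' p" "\<And>k. k < p \<Longrightarrow> ?l m k = ?l m' k"
    using less unfolding less_poly_mapping.rep_eq less_fun_def by blast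
  \<comment> \<open>Below \<open>p\<close> the exponents agree and at \<open>p\<close> that of
    \<open>m'\<close> is larger. So trading an index where \<open>m\<close> has the larger exponent
    for \<open>p\<close> lowers the index, as stability requires.\<close>
  have gt: "p < i" if "?l m' i < ?l m i" for i
  proof (rule ccontr)
    assume "\<not> p < i"
    then consider "i = p" | "i < p" by fastforce
    then show False using p that by cases (auto simp: p(2))
  qed
  have mem: "?thesis" if i: "?l m' i < ?l m i" and ex: "monomial (exchange m p i) \<in> I" for i
  proof -
    have "mdeg (exchange m p i) = d" using i deg by (simp add: mdeg_exchange)
    with ex have "exchange m p i \<in> min_gens I" by (simp add: in_min_gens_iff)
    with i gt[OF i] show ?thesis
      using exchange_greater[OF gt[OF i], of m] by (intro exI[of _ i] exI[of _ p]) auto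
  qed
  obtain i where i: "?l m' i < ?l m i"
    using ex_lookup_less_if_mdeg_eq[of m m'] deg less by auto
  show ?thesis
  proof (cases "strongly_stable_ideal I")
    case True
    have "i \<in> Poly_Mapping.keys m" using i by (simp add: in_keys_iff)
    then have "monomial (exchange m p i) \<in> I"
      using True I(1) gt[OF i] unfolding strongly_stable_ideal_def by blast
    with i show ?thesis by (rule mem)
  next
    case False
    then have stable: "stable_ideal I" and d: "d = 2" using st by auto
    have "m \<noteq> 0" using i by auto
    define t where "t = max_index m"
    have t: "t \<in> Poly_Mapping.keys m"
      unfolding t_def max_index_def using \<open>m \<noteq> 0\<close> by (intro Max_in) auto
    show ?thesis
    proof (cases "?l m' t < ?l m t")
      case True
      then have "monomial (exchange m p t) \<in> I"
        using stable I(1) gt \<open>m \<noteq> 0\<close> unfolding stable_ideal_def t_def by blast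
      with True show ?thesis by (rule mem)
    next
      case False
      have "?l m t \<noteq> 0" using t by (simp add: in_keys_iff)
      with False have "?l m' t \<noteq> 0" by simp
      \<comment> \<open>Both monomials have degree 2 and contain \<open>x_t\<close>. The cofactors
        \<open>u\<close> and \<open>u'\<close> are therefore single variables \<open>x_i\<close> and
        \<open>x_j\<close>, and exchanging these turns \<open>m\<close> into
        \<open>m'\<close>.\<close>
      obtain u where u: "m = Poly_Mapping.single t 1 + u"
        using \<open>?l m t \<noteq> 0\<close> by (rule lookup_neq_0E)
      obtain u' where u': "m' = Poly_Mapping.single t 1 + u'"
        using \<open>?l m' t \<noteq> 0\<close> by (rule lookup_neq_0E)
      have "mdeg u = 1" "mdeg u' = 1" using deg d by (simp_all add: u u' mdeg_add)
      have "?l u i \<noteq> 0" using i by (simp add: u u' lookup_add)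
      then obtain w where w: "u = Poly_Mapping.single i 1 + w" by (rule lookup_neq_0E)
      with \<open>mdeg u = 1\<close> have "w = 0" by (simp add: mdeg_add mdeg_eq_0_iff)
      have "u' \<noteq> 0" using \<open>mdeg u' = 1\<close> by auto
      then obtain j where "?l u' j \<noteq> 0" using poly_mapping_eqI[of u' 0] by auto
      then obtain w' where w': "u' = Poly_Mapping.single j 1 + w'" by (rule lookup_neq_0E)
      with \<open>mdeg u' = 1\<close> have "w' = 0" by (simp add: mdeg_add mdeg_eq_0_iff)
      have "exchange m j i = m'"
        unfolding exchange_def u u' w w' \<open>w = 0\<close> \<open>w' = 0\<close> by simp
      moreover have "j \<noteq> i" using less unfolding u u' w w' \<open>w = 0\<close> \<open>w' = 0\<close> by auto
      ultimately show ?thesis using i m' less by blast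
    qed
  qed
qed

end

text \<open>The exponent vectors of the generators lie in the finite box of vectors bounded by
  \<open>a\<close>.\<close>

lemma finite_min_gens_determined:
  assumes "determined a (I :: ('n::finite, 'k::comm_ring_1) mpoly set)"
  shows "finite (min_gens I)"
proof -
  have "Poly_Mapping.lookup ` min_gens I
      \<subseteq> Pi\<^sub>E UNIV (\<lambda>i. {..Poly_Mapping.lookup a i})"
    using assms unfolding determined_def monomial_dvd_iff ex_eq_add_iff_lookup_le by auto
  moreover have "finite (Pi\<^sub>E UNIV (\<lambda>i::'n. {..Poly_Mapping.lookup a i}))"
    by (intro finite_PiE) auto
  ultimately have "finite (Poly_Mapping.lookup ` min_gens I)" by (rule finite_subset)
  then show ?thesis by (rule finite_imageD) (simp add: inj_on_def)
qed

lemma dual_has_linear_quotients: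
  fixes I :: "('n::{finite,linorder}, 'k::field) mpoly set"
  assumes mono: "monomial_ideal I" and det: "determined a I" and gen: "generated_in_degree d I"
    and st: "(stable_ideal I \<and> d = 2) \<or> strongly_stable_ideal I"
  shows "has_linear_quotients (dual_ideal a I)"
proof -
  let ?G = "min_gens I" and ?l = Poly_Mapping.lookup
  \<comment> \<open>\<open>rev\<close> turns the ascending list into the decreasing lexicographic
    one, so that larger generators come first.\<close>
  define xs where "xs = rev (sorted_list_of_set ?G)"
  define ys where "ys = map (\<lambda>m. a - m) xs"
  have fin: "finite ?G" using det by (rule finite_min_gens_determined)
  have xs: "set xs = ?G" "distinct xs" using fin by (simp_all add: xs_def)
  have le: "?l m i \<le> ?l a i" if "m \<in> ?G" for m i
    using det that unfolding determined_def monomial_dvd_iff ex_eq_add_iff_lookup_le by blast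
  have sorted: "xs ! k' < xs ! k" if "k < k'" "k' < length xs" for k k'
  proof -
    have "sorted_wrt (>) xs"
      unfolding xs_def sorted_wrt_rev by (simp add: strict_sorted_list_of_set)
    then show ?thesis using that by (simp add: sorted_wrt_iff_nth_less)
  qed
  have inj: "inj_on (\<lambda>m. a - m) ?G"
  proof (rule inj_onI)
    fix m m' assume *: "m \<in> ?G" "m' \<in> ?G" "a - m = a - m'"
    show "m = m'"
    proof (rule poly_mapping_eqI)
      fix i
      have "?l a i - ?l m i = ?l a i - ?l m' i"
        using arg_cong[OF *(3), of "\<lambda>m. ?l m i"] by (simp add: lookup_minus)
      then show "?l m i = ?l m' i"
        using le[OF *(1), of i] le[OF *(2), of i] by linarith
    qed
  qed
  have colon: "colon_ideal (ideal_gen (monomial ` set (take k ys))) (monomial (ys ! k))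
      = (ideal_gen (var ` {i. \<exists>r\<in>set (take k ys). \<exists>u. Poly_Mapping.single i 1 + ys ! k = r + u})
        :: ('n, 'k) mpoly set)"
    if k: "k < length ys" for k
  proof (rule colon_ideal_eq_vars)
    let ?m = "xs ! k"
    have k: "k < length xs" using k by (simp add: ys_def)
    have m: "?m \<in> ?G" using nth_mem[OF k] xs by simp
    have yk: "ys ! k = a - ?m" using k by (simp add: ys_def)
    fix s assume "s \<in> set (take k ys)"
    then obtain k' where k': "k' < k" "s = a - xs ! k'"
      using k by (auto simp: in_set_conv_nth ys_def)
    have m': "xs ! k' \<in> ?G" using nth_mem[of k' xs] k k' xs by simp
    obtain i j where ij: "?l (xs ! k') i < ?l ?m i" "j \<noteq> i" "exchange ?m j i \<in> ?G" "?m < exchange ?m j i"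
      using exchange_in_min_gens[OF mono gen st m m' sorted[OF k'(1) k]] by blast
    obtain k'' where k'': "k'' < length xs" "xs ! k'' = exchange ?m j i"
      using ij(3) xs by (metis in_set_conv_nth)
    \<comment> \<open>The exchanged generator is lexicographically larger than
      \<open>xs ! k\<close>, so it stands earlier in the list and its dual is among the first
      \<open>k\<close> entries of \<open>ys\<close>.\<close>
    have "\<not> k < k''" "k \<noteq> k''" using ij(4) k'' sorted[of k k''] by auto
    then have "k'' < k" by simp
    then have "ys ! k'' \<in> set (take k ys)"
      using k by (auto simp: in_set_conv_nth ys_def intro!: exI[of _ k''])
    then have "a - exchange ?m j i \<in> set (take k ys)"
      using k'' by (simp add: ys_def)
    moreover have "?l (ys ! k) i < ?l s i"
      using ij(1) le[OF m, of i] by (simp add: k' yk lookup_minus)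
    \<comment> \<open>With \<open>m' = m x_j / x_i\<close> this is
      \<open>x_i (x^a / m) = x_j (x^a / m')\<close>, which puts \<open>x_i\<close> in the colon
      ideal. Neither subtraction truncates, because both generators divide
      \<open>x^a\<close>.\<close>
    moreover have "Poly_Mapping.single i 1 + ys ! k
        = a - exchange ?m j i + Poly_Mapping.single j 1"
    proof (rule poly_mapping_eqI)
      fix t
      show "?l (Poly_Mapping.single i 1 + ys ! k) t
          = ?l (a - exchange ?m j i + Poly_Mapping.single j 1) t"
        using ij(1,2) le[OF m, of t] le[OF ij(3), of t]
        by (auto simp: yk lookup_add lookup_minus lookup_single when_def lookup_exchange split: if_splits)
    qed
    ultimately show "\<exists>i r u. ?l (ys ! k) i < ?l s i \<and>
        r \<in> set (take k ys) \<and> Poly_Mapping.single i 1 + ys ! k = r + u"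
      by blast
  qed
  have "distinct ys" using inj xs by (simp add: ys_def distinct_map)
  moreover have "set ys = {a - m | m. m \<in> ?G}" by (auto simp: ys_def xs(1))
  ultimately show ?thesis
    unfolding has_linear_quotients_def min_gens_dual[OF mono det]
  proof (intro exI[of _ ys] conjI allI impI)
    fix k assume "1 \<le> k \<and> k < length ys"
    then show "\<exists>V. colon_ideal (ideal_gen (monomial ` set (take k ys))) (monomial (ys ! k))
        = (ideal_gen (var ` V) :: ('n, 'k) mpoly set)"
      by (intro exI) (rule colon, simp)
  qed
qed

section \<open>Homogeneous components\<close>

definition homogeneous :: "nat \<Rightarrow> ('n::finite, 'k::comm_ring_1) mpoly \<Rightarrow> bool" where
  "homogeneous k p \<longleftrightarrow> (\<forall>t\<in>Poly_Mapping.keys p. mdeg t = k)"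

definition hcomp :: "nat \<Rightarrow> ('n::finite, 'k::comm_ring_1) mpoly \<Rightarrow> ('n, 'k) mpoly" where
  "hcomp k p = Poly_Mapping.mapp (\<lambda>t c. if mdeg t = k then c else 0) p"

lemma lookup_hcomp:
  "Poly_Mapping.lookup (hcomp k p) t = (if mdeg t = k then Poly_Mapping.lookup p t else 0)"
  by (auto simp: hcomp_def lookup_mapp when_def in_keys_iff)

lemma homogeneous_lookup: "homogeneous k p \<longleftrightarrow> (\<forall>t. mdeg t \<noteq> k \<longrightarrow> Poly_Mapping.lookup p t = 0)"
  by (auto simp: homogeneous_def in_keys_iff)

lemma homogeneous_0 [simp]: "homogeneous k 0"
  by (simp add: homogeneous_def)

lemma homogeneous_uminus: "homogeneous k p \<Longrightarrow> homogeneous k (- p)"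
  by (simp add: homogeneous_lookup)

lemma homogeneous_sum: "(\<And>x. x \<in> X \<Longrightarrow> homogeneous k (f x)) \<Longrightarrow> homogeneous k (sum f X)"
  by (simp add: homogeneous_lookup lookup_sum)

lemma homogeneous_mult:
  assumes "homogeneous l p" "homogeneous k q"
  shows "homogeneous (l + k) (p * q)"
  using assms keys_mult[of p q] unfolding homogeneous_def by (fastforce simp: mdeg_add)

lemma homogeneous_monomial: "homogeneous (mdeg m) (monomial m)"
  by (simp add: homogeneous_def monomial_def)

lemma homogeneous_hcomp: "homogeneous k (hcomp k p)"
  by (simp add: homogeneous_lookup lookup_hcomp)

lemma hcomp_eq: "homogeneous k p \<Longrightarrow> hcomp k p = p"
  by (rule poly_mapping_eqI) (simp add: homogeneous_lookup lookup_hcomp)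

lemma hcomp_add: "hcomp k (p + q) = hcomp k p + hcomp k q"
  by (rule poly_mapping_eqI) (simp add: lookup_hcomp lookup_add)

lemma hcomp_sum: "hcomp k (sum f X) = (\<Sum>x\<in>X. hcomp k (f x))"
  by (rule poly_mapping_eqI) (simp add: lookup_hcomp lookup_sum)

text \<open>The rest \<open>p - hcomp k p\<close> has no term of degree \<open>k\<close>, so its
  product with the homogeneous \<open>q\<close> has none of degree \<open>l + k\<close>.\<close>

lemma hcomp_mult:
  assumes "homogeneous l q"
  shows "hcomp (l + k) (q * p) = q * hcomp k p"
proof -
  have "hcomp (l + k) (q * (p - hcomp k p)) = 0"
  proof (rule poly_mapping_eqI)
    fix t
    have "mdeg t \<noteq> l + k" if t: "t \<in> Poly_Mapping.keys (q * (p - hcomp k p))"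
    proof -
      obtain u v where uv: "t = u + v" "u \<in> Poly_Mapping.keys q" "v \<in> Poly_Mapping.keys (p - hcomp k p)"
        using t keys_mult[of q "p - hcomp k p"] by blast
      then have "mdeg u = l" "mdeg v \<noteq> k"
        using assms by (auto simp: homogeneous_def in_keys_iff lookup_minus lookup_hcomp)
      then show ?thesis by (simp add: uv mdeg_add)
    qed
    then show "Poly_Mapping.lookup (hcomp (l + k) (q * (p - hcomp k p))) t = Poly_Mapping.lookup 0 t"
      by (auto simp: lookup_hcomp in_keys_iff)
  qed
  moreover have "q * p = q * hcomp k p + q * (p - hcomp k p)"
    by (simp add: algebra_simps)
  ultimately show ?thesis
    using hcomp_eq[OF homogeneous_mult[OF assms homogeneous_hcomp]] by (simp add: hcomp_add)
qed

text \<open>In a linear resolution all basis elements of one free module have the same degree. A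
  graded map is then a matrix whose nonzero entries share one degree, and no shifts need to be
  carried along.\<close>

definition hom_mat :: "nat \<Rightarrow> ('n::finite, 'k::comm_ring_1) mpoly mat \<Rightarrow> bool" where
  "hom_mat k M \<longleftrightarrow> (\<forall>i<dim_row M. \<forall>j<dim_col M. homogeneous k (M $$ (i, j)))"

lemma hom_mat_mult:
  assumes "hom_mat l A" "hom_mat k B" "dim_col A = dim_row B"
  shows "hom_mat (l + k) (A * B)"
  using assms unfolding hom_mat_def
  by (auto simp: scalar_prod_def intro!: homogeneous_sum homogeneous_mult)

lemma hom_mat_four_block:
  assumes "hom_mat k A" "hom_mat k B" "hom_mat k C" "hom_mat k D"
    and "dim_row B = dim_row A" "dim_col C = dim_col A" "dim_row D = dim_row C" "dim_col D = dim_col B"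
  shows "hom_mat k (four_block_mat A B C D)"
  using assms unfolding hom_mat_def by auto

text \<open>Arbitrary solutions \<open>w j\<close> for the columns can be replaced by their
  components of degree \<open>k\<close>: comparing the components of degree \<open>l + k\<close> in
  \<open>A w = col M j\<close> shows that these still solve the equations.\<close>

lemma hom_mat_lift:
  assumes A: "A \<in> carrier_mat p q" "hom_mat l A"
    and M: "M \<in> carrier_mat p c" "hom_mat (l + k) M"
    and ex: "\<And>j. j < c \<Longrightarrow> \<exists>w\<in>carrier_vec q. A *\<^sub>v w = col M j"
  shows "\<exists>N\<in>carrier_mat q c. hom_mat k N \<and> A * N = M"
proof -
  obtain w where w: "w j \<in> carrier_vec q" "A *\<^sub>v w j = col M j" if "j < c" for j
    using ex by metis
  define N where "N = mat q c (\<lambda>(i, j). hcomp k (w j $ i))"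
  have "A * N = M"
  proof (rule eq_matI)
    fix i j assume ij: "i < dim_row M" "j < dim_col M"
    then have i: "i < p" and j: "j < c" using M by auto
    have "M $$ (i, j) = (A *\<^sub>v w j) $ i" using w(2)[OF j] i j M by simp
    also have "\<dots> = (\<Sum>t\<in>{0..<q}. A $$ (i, t) * w j $ t)"
      using A i w(1)[OF j] by (auto simp: scalar_prod_def intro!: sum.cong)
    finally have "M $$ (i, j) = (\<Sum>t\<in>{0..<q}. A $$ (i, t) * w j $ t)" .
    then have "hcomp (l + k) (M $$ (i, j)) = (\<Sum>t\<in>{0..<q}. A $$ (i, t) * hcomp k (w j $ t))"
      using A i by (auto simp: hcomp_sum hom_mat_def intro!: sum.cong hcomp_mult)
    moreover have "hcomp (l + k) (M $$ (i, j)) = M $$ (i, j)"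
      using M ij by (intro hcomp_eq) (simp add: hom_mat_def)
    moreover have "(A * N) $$ (i, j) = (\<Sum>t\<in>{0..<q}. A $$ (i, t) * hcomp k (w j $ t))"
      using A i j by (auto simp: scalar_prod_def N_def intro!: sum.cong)
    ultimately show "(A * N) $$ (i, j) = M $$ (i, j)" by simp
  qed (use A M in \<open>auto simp: N_def\<close>)
  moreover have "hom_mat k N" by (simp add: hom_mat_def N_def homogeneous_hcomp)
  ultimately show ?thesis by (intro bexI[of _ N]) (simp_all add: N_def)
qed

section \<open>Linear resolutions and mapping cones\<close>

text \<open>
  The indices are shifted against those of \<open>graded_free_resolution\<close>: \<open>p 0 = 1\<close> is the rank of the
  ring itself, the target of the augmentation \<open>A 0\<close>, and \<open>p (Suc i)\<close> is the rank of \<open>F\<^sub>i\<close>.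
\<close>

definition linear_res ::
  "nat \<Rightarrow> (nat \<Rightarrow> nat) \<Rightarrow> (nat \<Rightarrow> ('n::finite, 'k::comm_ring_1) mpoly mat) \<Rightarrow> ('n, 'k) mpoly set \<Rightarrow> bool" where
  "linear_res e p A J \<longleftrightarrow> p 0 = 1 \<and>
     (\<forall>i. A i \<in> carrier_mat (p i) (p (Suc i))) \<and>
     (\<forall>i. hom_mat (if i = 0 then e else 1) (A i)) \<and>
     (\<lambda>v. (A 0 *\<^sub>v v) $ 0) ` carrier_vec (p 1) = J \<and>
     (\<forall>i. (\<lambda>v. A (Suc i) *\<^sub>v v) ` carrier_vec (p (Suc (Suc i))) = mat_kernel (A i))"

text \<open>The basis elements of \<open>F_i\<close> get degree \<open>e + i\<close>. Beyond the
  augmentation all entries are linear, so they have no constant term, which gives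
  minimality.\<close>

lemma linear_res_imp_has_linear_resolution:
  assumes "linear_res e p A J"
  shows "has_linear_resolution J"
proof -
  have p0: "p 0 = 1" and A: "\<And>i. A i \<in> carrier_mat (p i) (p (Suc i))"
    and hom: "\<And>i. hom_mat (if i = 0 then e else 1) (A i)"
    and im: "(\<lambda>v. (A 0 *\<^sub>v v) $ 0) ` carrier_vec (p 1) = J"
    and ex: "\<And>i. (\<lambda>v. A (Suc i) *\<^sub>v v) ` carrier_vec (p (Suc (Suc i))) = mat_kernel (A i)"
    using assms by (auto simp: linear_res_def)
  have deg: "mdeg t = (if i = 0 then e else 1)"
    if "r < p i" "c < p (Suc i)" "t \<in> Poly_Mapping.keys (A i $$ (r, c))" for i r c t
    using hom[of i] A[of i] that by (auto simp: hom_mat_def homogeneous_def)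
  have minimal: "A (Suc i) $$ (r, c) \<in> ideal_gen (var ` UNIV)"
    if "r < p (Suc i)" "c < p (Suc (Suc i))" for i r c
    unfolding in_ideal_gen_vars ex_eq_single_add_iff
  proof
    fix t assume "t \<in> Poly_Mapping.keys (A (Suc i) $$ (r, c))"
    then have "mdeg t = 1" using deg[OF that] by simp
    then have "t \<noteq> 0" by auto
    then show "\<exists>i\<in>UNIV. Poly_Mapping.lookup t i \<noteq> 0"
      by (metis UNIV_I lookup_zero poly_mapping_eqI)
  qed
  have "graded_free_resolution (\<lambda>i. p (Suc i)) (\<lambda>i j. e + i) A J"
    unfolding graded_free_resolution_def
  proof (intro conjI allI impI ballI)
    show "A 0 \<in> carrier_mat 1 (p (Suc 0))" using A[of 0] p0 by simp
    show "A (Suc i) \<in> carrier_mat (p (Suc i)) (p (Suc (Suc i)))" for i by (rule A)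
    show "mdeg t = e + 0" if "c < p (Suc 0)" "t \<in> Poly_Mapping.keys (A 0 $$ (0, c))" for c t
      using deg[of 0 0 c t] that p0 by simp
    show "mdeg t + (e + i) = e + Suc i"
      if "r < p (Suc i)" "c < p (Suc (Suc i))" "t \<in> Poly_Mapping.keys (A (Suc i) $$ (r, c))" for i r c t
      using deg[OF that] by simp
    show "(\<lambda>v. (A 0 *\<^sub>v v) $ 0) ` carrier_vec (p (Suc 0)) = J" using im by simp
    show "(\<lambda>v. A (Suc i) *\<^sub>v v) ` carrier_vec (p (Suc (Suc i))) = mat_kernel (A i)" for i by (rule ex)
  qed
  then have "minimal_graded_free_resolution (\<lambda>i. p (Suc i)) (\<lambda>i j. e + i) A J"
    unfolding minimal_graded_free_resolution_def using minimal by simp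
  then show ?thesis
    unfolding has_linear_resolution_def
    by (intro exI[of _ e] exI[of _ "\<lambda>i. p (Suc i)"] exI[of _ "\<lambda>i j. e + i"] exI[of _ A]) simp
qed

text \<open>The ring followed by zero modules. The degree \<open>e\<close> is arbitrary, so this
  starts the induction for ideals of variables as well as that for linear quotients.\<close>

lemma linear_res_zero: "\<exists>p A. linear_res e p A ({0} :: ('n::finite, 'k::comm_ring_1) mpoly set)"
proof -
  define p :: "nat \<Rightarrow> nat" where "p i = (if i = 0 then 1 else 0)" for i
  define A where "A i = (0\<^sub>m (p i) 0 :: ('n, 'k) mpoly mat)" for i
  have c0: "carrier_vec 0 = {0\<^sub>v 0 :: ('n, 'k) mpoly vec}"
    unfolding carrier_vec_def vec_of_dim_0 by (rule singleton_conv)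
  have A: "A i \<in> carrier_mat (p i) 0" for i by (simp add: A_def)
  have A0: "A i *\<^sub>v 0\<^sub>v 0 = 0\<^sub>v (p i)" for i by (rule eq_vecI) (simp_all add: A_def)
  have ker: "mat_kernel (A i) = {0\<^sub>v 0}" for i
    unfolding mat_kernel[OF A] c0 using A0[of i] by blast
  have p: "p 0 = 1" "p (Suc i) = 0" for i by (simp_all add: p_def)
  have "linear_res e p A {0}"
    unfolding linear_res_def One_nat_def p(2) ker c0 image_insert image_empty A0
    using A by (simp add: p hom_mat_def A_def)
  then show ?thesis by (intro exI)
qed

section \<open>Exactness and degrees of the mapping cone\<close>

lemma mult_mat_vec_uminus:
  fixes A :: "'a::comm_ring_1 mat"
  assumes "A \<in> carrier_mat nr nc" "v \<in> carrier_vec nc"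
  shows "A *\<^sub>v (- v) = - (A *\<^sub>v v)"
  using assms by (intro eq_vecI) auto

text \<open>Exactness of a mapping cone at one place; the sign of \<open>Q\<close> makes consecutive
  differentials compose to zero. In \<open>exQ\<close> a preimage of \<open>y\<close> is demanded
  only if \<open>F y\<close> cancels against the image of \<open>A\<close>. At the bottom of the
  cone, where \<open>Q\<close> is zero, this condition expresses membership in the colon
  ideal.\<close>

lemma mat_ker_im_cone:
  fixes A :: "'a::comm_ring_1 mat"
  assumes A: "A \<in> carrier_mat p0 p1" "A' \<in> carrier_mat p1 p2"
    and Q: "Q \<in> carrier_mat r0 r1" "Q' \<in> carrier_mat r1 r2"
    and F: "F \<in> carrier_mat p0 r1" "F' \<in> carrier_mat p1 r2"
    and comm: "A * F' = F * Q'"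
    and exA: "(\<lambda>v. A' *\<^sub>v v) ` carrier_vec p2 = mat_kernel A"
    and QQ: "\<And>y. y \<in> carrier_vec r2 \<Longrightarrow> Q *\<^sub>v (Q' *\<^sub>v y) = 0\<^sub>v r0"
    and exQ: "\<And>z y. z \<in> carrier_vec p1 \<Longrightarrow> y \<in> carrier_vec r1 \<Longrightarrow> A *\<^sub>v z + F *\<^sub>v y = 0\<^sub>v p0 \<Longrightarrow>
      Q *\<^sub>v y = 0\<^sub>v r0 \<Longrightarrow> \<exists>x\<in>carrier_vec r2. Q' *\<^sub>v x = y"
  shows "(\<lambda>v. four_block_mat A' F' (0\<^sub>m r1 p2) (- Q') *\<^sub>v v) ` carrier_vec (p2 + r2)
    = mat_kernel (four_block_mat A F (0\<^sub>m r0 p1) (- Q))" (is "?f ` _ = mat_kernel ?D")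
proof -
  have D: "?D \<in> carrier_mat (p0 + r0) (p1 + r1)" using A Q by (intro four_block_carrier_mat) auto
  have f: "?f (z @\<^sub>v y) = (A' *\<^sub>v z + F' *\<^sub>v y) @\<^sub>v - (Q' *\<^sub>v y)"
    if "z \<in> carrier_vec p2" "y \<in> carrier_vec r2" for z y
    using A Q F that by (subst four_block_mat_mult_vec[OF A(2) F(2) _ _ that]) (auto simp: uminus_carrier_mat)
  have d: "?D *\<^sub>v (z @\<^sub>v y) = (A *\<^sub>v z + F *\<^sub>v y) @\<^sub>v - (Q *\<^sub>v y)"
    if "z \<in> carrier_vec p1" "y \<in> carrier_vec r1" for z y
    using A Q F that by (subst four_block_mat_mult_vec[OF A(1) F(1) _ _ that]) (auto simp: uminus_carrier_mat)
  have zero: "0\<^sub>v (p0 + r0) = 0\<^sub>v p0 @\<^sub>v 0\<^sub>v r0" by auto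
  have comm': "A *\<^sub>v (F' *\<^sub>v y) = F *\<^sub>v (Q' *\<^sub>v y)" if "y \<in> carrier_vec r2" for y
    using arg_cong[OF comm, of "\<lambda>M. M *\<^sub>v y"] A F Q that by simp
  have ker: "z @\<^sub>v y \<in> mat_kernel ?D \<longleftrightarrow> A *\<^sub>v z + F *\<^sub>v y = 0\<^sub>v p0 \<and> Q *\<^sub>v y = 0\<^sub>v r0"
    if "z \<in> carrier_vec p1" "y \<in> carrier_vec r1" for z y
  proof -
    have c: "A *\<^sub>v z + F *\<^sub>v y \<in> carrier_vec p0" "Q *\<^sub>v y \<in> carrier_vec r0"
      using A F Q that by auto
    have "- (Q *\<^sub>v y) = 0\<^sub>v r0 \<longleftrightarrow> Q *\<^sub>v y = 0\<^sub>v r0"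
      using c(2) by (metis uminus_uminus_vec uminus_zero_vec)
    then show ?thesis
      unfolding mat_kernel[OF D] zero using that c(1) by (simp add: d append_vec_eq[OF c(1)])
  qed
  have zeroA: "A *\<^sub>v (A' *\<^sub>v z) = 0\<^sub>v p0" if "z \<in> carrier_vec p2" for z
  proof -
    have "A' *\<^sub>v z \<in> mat_kernel A" unfolding exA[symmetric] using that by (rule imageI)
    then show ?thesis by (rule mat_kernelD(2)[OF A(1)])
  qed
  show ?thesis
  proof (intro subset_antisym subsetI)
    fix v assume "v \<in> ?f ` carrier_vec (p2 + r2)"
    then obtain w where w: "w \<in> carrier_vec (p2 + r2)" "v = ?f w" by blast
    define z y where "z = vec_first w p2" "y = vec_last w r2"
    have zy: "z \<in> carrier_vec p2" "y \<in> carrier_vec r2" "w = z @\<^sub>v y"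
      using w(1) by (simp_all add: z_y_def)
    have c: "A' *\<^sub>v z \<in> carrier_vec p1" "F' *\<^sub>v y \<in> carrier_vec p1" "Q' *\<^sub>v y \<in> carrier_vec r1"
      "F *\<^sub>v (Q' *\<^sub>v y) \<in> carrier_vec p0"
      using A F Q zy by auto
    have "A *\<^sub>v (A' *\<^sub>v z + F' *\<^sub>v y) + F *\<^sub>v (- (Q' *\<^sub>v y)) = 0\<^sub>v p0"
      using c zy A F Q by (simp add: mult_add_distrib_mat_vec[OF A(1)] zeroA comm' mult_mat_vec_uminus[OF F(1)])
    moreover have "Q *\<^sub>v (- (Q' *\<^sub>v y)) = 0\<^sub>v r0"
      using c Q QQ[OF zy(2)] by (simp add: mult_mat_vec_uminus[OF Q(1)])
    ultimately show "v \<in> mat_kernel ?D"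
      unfolding w(2) zy(3) f[OF zy(1,2)] using c by (subst ker) auto
  next
    fix v assume v: "v \<in> mat_kernel ?D"
    define z y where "z = vec_first v p1" "y = vec_last v r1"
    have "v \<in> carrier_vec (p1 + r1)" using v by (rule mat_kernelD(1)[OF D])
    then have zy: "z \<in> carrier_vec p1" "y \<in> carrier_vec r1" "v = z @\<^sub>v y"
      by (simp_all add: z_y_def)
    have k: "A *\<^sub>v z + F *\<^sub>v y = 0\<^sub>v p0" "Q *\<^sub>v y = 0\<^sub>v r0"
      using v unfolding zy(3) ker[OF zy(1,2)] by simp_all
    \<comment> \<open>Diagram chase: \<open>z + F' x\<close> is a cycle for \<open>A\<close>, hence
      equal to some \<open>A' u\<close>, and the pair of \<open>u\<close> and \<open>- x\<close> is
      mapped to the pair of \<open>z\<close> and \<open>y\<close>.\<close>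
    obtain x where x: "x \<in> carrier_vec r2" "Q' *\<^sub>v x = y" using exQ[OF zy(1,2) k] by blast
    have c: "F' *\<^sub>v x \<in> carrier_vec p1" using F x by auto
    have "A *\<^sub>v (z + F' *\<^sub>v x) = A *\<^sub>v z + F *\<^sub>v y"
      unfolding mult_add_distrib_mat_vec[OF A(1) zy(1) c] comm'[OF x(1)] x(2) ..
    then have "A *\<^sub>v (z + F' *\<^sub>v x) = 0\<^sub>v p0" unfolding k(1) .
    then have "z + F' *\<^sub>v x \<in> mat_kernel A"
      using zy(1) c by (intro mat_kernelI[OF A(1)] add_carrier_vec)
    then have "z + F' *\<^sub>v x \<in> (\<lambda>v. A' *\<^sub>v v) ` carrier_vec p2" unfolding exA .
    then obtain u where u: "z + F' *\<^sub>v x = A' *\<^sub>v u" "u \<in> carrier_vec p2" by (rule imageE)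
    have "A' *\<^sub>v u + F' *\<^sub>v (- x) = z"
      unfolding u(1)[symmetric] mult_mat_vec_uminus[OF F(2) x(1)]
      using zy(1) c by (intro eq_vecI) auto
    moreover have "- (Q' *\<^sub>v (- x)) = y"
      unfolding mult_mat_vec_uminus[OF Q(2) x(1)] x(2) by simp
    moreover have "- x \<in> carrier_vec r2" using x(1) by simp
    ultimately have "v = ?f (u @\<^sub>v - x)"
      unfolding zy(3) by (simp only: f[OF u(2)])
    moreover have "u @\<^sub>v - x \<in> carrier_vec (p2 + r2)"
      using u(2) x(1) by (intro append_carrier_vec) simp_all
    ultimately show "v \<in> ?f ` carrier_vec (p2 + r2)" by (rule image_eqI)
  qed
qed

text \<open>Multiplication by \<open>g\<close> embeds \<open>R/(J : g)\<close>, shifted by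
  \<open>e\<close>, into \<open>R/J\<close> with cokernel \<open>R/(J + (g))\<close>. The cone of a
  lift of this map to the resolutions resolves the cokernel. The lift has degree \<open>e\<close> at
  the bottom and degree 1 above, exactly as the differentials of \<open>A\<close>, so the cone is
  linear again.\<close>

lemma linear_res_add_generator:
  fixes J :: "('n::finite, 'k::comm_ring_1) mpoly set"
  assumes J: "linear_res e p A J" and C: "linear_res 1 q B (colon_ideal J g)" and g: "homogeneous e g"
  shows "\<exists>p' D. linear_res e p' D {x + c * g | x c. x \<in> J}"
proof -
  let ?\<alpha> = "\<lambda>i::nat. if i = 0 then e else 1"
  have p0: "p 0 = 1" and A: "\<And>i. A i \<in> carrier_mat (p i) (p (Suc i))"
    and homA: "\<And>i. hom_mat (?\<alpha> i) (A i)"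
    and imA: "(\<lambda>v. (A 0 *\<^sub>v v) $ 0) ` carrier_vec (p 1) = J"
    and exA: "\<And>i. (\<lambda>v. A (Suc i) *\<^sub>v v) ` carrier_vec (p (Suc (Suc i))) = mat_kernel (A i)"
    using J by (auto simp: linear_res_def)
  have q0: "q 0 = 1" and B: "\<And>i. B i \<in> carrier_mat (q i) (q (Suc i))"
    and homB: "\<And>i. hom_mat 1 (B i)"
    and imB: "(\<lambda>v. (B 0 *\<^sub>v v) $ 0) ` carrier_vec (q 1) = colon_ideal J g"
    and exB: "\<And>i. (\<lambda>v. B (Suc i) *\<^sub>v v) ` carrier_vec (q (Suc (Suc i))) = mat_kernel (B i)"
    using C unfolding linear_res_def if_cancel by blast+
  have BB: "B i *\<^sub>v (B (Suc i) *\<^sub>v y) = 0\<^sub>v (q i)" if "y \<in> carrier_vec (q (Suc (Suc i)))" for i y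
  proof -
    have "B (Suc i) *\<^sub>v y \<in> mat_kernel (B i)" unfolding exB[symmetric] using that by (rule imageI)
    then show ?thesis by (rule mat_kernelD(2)[OF B])
  qed

  \<comment> \<open>The cone needs a chain map \<open>F\<close> from the shifted augmented resolution of \<open>J : g\<close> to that of
    \<open>J\<close>, starting with multiplication by \<open>g\<close>; the last condition lets the construction continue.\<close>
  define lifts where "lifts i F \<longleftrightarrow> F \<in> carrier_mat (p i) (q i) \<and> hom_mat (?\<alpha> i) F \<and>
    (\<forall>y\<in>carrier_vec (q (Suc i)). F *\<^sub>v (B i *\<^sub>v y) \<in> (\<lambda>v. A i *\<^sub>v v) ` carrier_vec (p (Suc i)))" for i F
  define g1 where "g1 = mat 1 1 (\<lambda>_. g)"
  have g1: "g1 \<in> carrier_mat (p 0) (q 0)" by (simp add: g1_def p0 q0)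
  have g1_mult: "(g1 *\<^sub>v y) $ 0 = g * y $ 0" if "y \<in> carrier_vec 1" for y
    using that by (simp add: g1_def scalar_prod_def)
  have "lifts 0 g1"
    unfolding lifts_def
  proof (intro conjI ballI)
    show "hom_mat (?\<alpha> 0) g1" using g by (simp add: hom_mat_def g1_def)
    fix y :: "('n, 'k) mpoly vec" assume y: "y \<in> carrier_vec (q (Suc 0))"
    have By: "B 0 *\<^sub>v y \<in> carrier_vec 1" using B[of 0] y q0 by auto
    have "(B 0 *\<^sub>v y) $ 0 \<in> colon_ideal J g"
      unfolding imB[symmetric] One_nat_def using y by (rule imageI)
    then have "(B 0 *\<^sub>v y) $ 0 * g \<in> J" by (simp add: colon_ideal_def)
    then obtain w where w: "(B 0 *\<^sub>v y) $ 0 * g = (A 0 *\<^sub>v w) $ 0" "w \<in> carrier_vec (p (Suc 0))"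
      unfolding imA[symmetric] One_nat_def by (rule imageE)
    have "g1 *\<^sub>v (B 0 *\<^sub>v y) = A 0 *\<^sub>v w"
    proof (rule eq_vecI)
      fix i assume "i < dim_vec (A 0 *\<^sub>v w)"
      then have "i = 0" using A[of 0] p0 by simp
      then show "(g1 *\<^sub>v (B 0 *\<^sub>v y)) $ i = (A 0 *\<^sub>v w) $ i"
        using g1_mult[OF By] w(1) by (simp only: mult.commute)
    qed (use A[of 0] p0 in \<open>simp add: g1_def\<close>)
    then show "g1 *\<^sub>v (B 0 *\<^sub>v y) \<in> (\<lambda>v. A 0 *\<^sub>v v) ` carrier_vec (p (Suc 0))"
      using w(2) by (rule image_eqI)
  qed (rule g1)
  have step: "\<exists>F'. lifts (Suc i) F' \<and> A i * F' = F * B i" if F: "lifts i F" for i F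
  proof -
    have Fc: "F \<in> carrier_mat (p i) (q i)" and Fh: "hom_mat (?\<alpha> i) F"
      and Fl: "\<And>y. y \<in> carrier_vec (q (Suc i)) \<Longrightarrow>
        F *\<^sub>v (B i *\<^sub>v y) \<in> (\<lambda>v. A i *\<^sub>v v) ` carrier_vec (p (Suc i))"
      using F unfolding lifts_def by simp_all
    have FB: "F * B i \<in> carrier_mat (p i) (q (Suc i))" using Fc B[of i] by simp
    \<comment> \<open>A column of \<open>F * B i\<close> is the value at a unit vector, which lies
      in the image of \<open>A i\<close> by the last condition of \<open>lifts\<close>. The degrees
      leave degree 1 for the lift.\<close>
    have "\<exists>N\<in>carrier_mat (p (Suc i)) (q (Suc i)). hom_mat 1 N \<and> A i * N = F * B i"
    proof (rule hom_mat_lift[OF A homA FB])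
      show "hom_mat (?\<alpha> i + 1) (F * B i)"
        using Fc B[of i] by (intro hom_mat_mult[OF Fh homB]) simp
      fix j assume j: "j < q (Suc i)"
      have "B i *\<^sub>v unit_vec (q (Suc i)) j = col (B i) j"
        using j B[of i] by (intro eq_vecI) simp_all
      then have "col (F * B i) j = F *\<^sub>v (B i *\<^sub>v unit_vec (q (Suc i)) j)"
        using j Fc B[of i] by (intro eq_vecI) simp_all
      then have "col (F * B i) j \<in> (\<lambda>v. A i *\<^sub>v v) ` carrier_vec (p (Suc i))"
        using Fl[of "unit_vec (q (Suc i)) j"] by simp
      then obtain w where "col (F * B i) j = A i *\<^sub>v w" "w \<in> carrier_vec (p (Suc i))" by (rule imageE)
      then show "\<exists>w\<in>carrier_vec (p (Suc i)). A i *\<^sub>v w = col (F * B i) j"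
        by (intro bexI[of _ w]) simp_all
    qed
    then obtain N where N: "N \<in> carrier_mat (p (Suc i)) (q (Suc i))" "hom_mat 1 N" "A i * N = F * B i"
      by blast
    \<comment> \<open>Since \<open>A i * N = F * B i\<close> and \<open>B i\<close> kills the image
      of \<open>B (Suc i)\<close>, the left side lies in the kernel of \<open>A i\<close>; exactness
      turns this into the condition for the next step.\<close>
    have "N *\<^sub>v (B (Suc i) *\<^sub>v y) \<in> (\<lambda>v. A (Suc i) *\<^sub>v v) ` carrier_vec (p (Suc (Suc i)))"
      if y: "y \<in> carrier_vec (q (Suc (Suc i)))" for y
      unfolding exA
    proof (rule mat_kernelI[OF A])
      have By: "B (Suc i) *\<^sub>v y \<in> carrier_vec (q (Suc i))" using B y by (rule mult_mat_vec_carrier)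
      show "N *\<^sub>v (B (Suc i) *\<^sub>v y) \<in> carrier_vec (p (Suc i))" using N(1) By by (rule mult_mat_vec_carrier)
      have "A i *\<^sub>v (N *\<^sub>v (B (Suc i) *\<^sub>v y)) = (F * B i) *\<^sub>v (B (Suc i) *\<^sub>v y)"
        unfolding N(3)[symmetric] using assoc_mult_mat_vec[OF A N(1) By] by (rule sym)
      also have "\<dots> = F *\<^sub>v (B i *\<^sub>v (B (Suc i) *\<^sub>v y))" by (rule assoc_mult_mat_vec[OF Fc B By])
      also have "\<dots> = 0\<^sub>v (p i)" unfolding BB[OF y] using Fc by (intro eq_vecI) auto
      finally show "A i *\<^sub>v (N *\<^sub>v (B (Suc i) *\<^sub>v y)) = 0\<^sub>v (p i)" .
    qed
    then have "lifts (Suc i) N" unfolding lifts_def using N by simp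
    with N(3) show ?thesis by (intro exI[of _ N] conjI)
  qed
  obtain F where F0: "F 0 = g1" and F: "\<And>i. lifts i (F i)" and comm: "\<And>i. A i * F (Suc i) = F i * B i"
  proof -
    \<comment> \<open>The clause for \<open>n = 0\<close> pins the start of the chosen sequence to
      multiplication by \<open>g\<close>.\<close>
    have "\<exists>f. \<forall>n. (lifts n (f n) \<and> (n = 0 \<longrightarrow> f n = g1)) \<and> A n * f (Suc n) = f n * B n"
    proof (rule dependent_nat_choice)
      show "\<exists>x. lifts 0 x \<and> (0 = 0 \<longrightarrow> x = g1)" using \<open>lifts 0 g1\<close> by (intro exI[of _ g1]) simp
      show "\<exists>y. (lifts (Suc n) y \<and> (Suc n = 0 \<longrightarrow> y = g1)) \<and> A n * y = x * B n"
        if "lifts n x \<and> (n = 0 \<longrightarrow> x = g1)" for x n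
        using step[of n x] that by simp
    qed
    then obtain f where "\<forall>n. (lifts n (f n) \<and> (n = 0 \<longrightarrow> f n = g1)) \<and> A n * f (Suc n) = f n * B n" ..
    then show ?thesis by (intro that[of f]) simp_all
  qed
  have Fc: "F i \<in> carrier_mat (p i) (q i)" and Fh: "hom_mat (?\<alpha> i) (F i)" for i
    using F[of i] unfolding lifts_def by simp_all

  \<comment> \<open>Index shift in the cone; \<open>Q 0\<close> is the zero map out of the rank one module that maps to \<open>g\<close>.\<close>
  define r where "r i = (case i of 0 \<Rightarrow> 0 | Suc j \<Rightarrow> q j)" for i
  define Q where "Q i = (case i of 0 \<Rightarrow> 0\<^sub>m 0 1 | Suc j \<Rightarrow> B j)" for i
  define D where "D i = four_block_mat (A i) (F i) (0\<^sub>m (r i) (p (Suc i))) (- Q i)" for i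
  have r: "r 0 = 0" "r (Suc i) = q i" for i by (simp_all add: r_def)
  have Q: "Q i \<in> carrier_mat (r i) (q i)" for i
    by (cases i) (simp_all add: Q_def r_def q0 B)
  have Dc: "D i \<in> carrier_mat (p i + r i) (p (Suc i) + q i)" for i
    unfolding D_def using Q[of i] by (intro four_block_carrier_mat[OF A]) (simp add: uminus_carrier_mat)
  have homD: "hom_mat (?\<alpha> i) (D i)" for i
    unfolding D_def
  proof (rule hom_mat_four_block[OF homA Fh])
    show "hom_mat (?\<alpha> i) (0\<^sub>m (r i) (p (Suc i)))" by (simp add: hom_mat_def)
    show "hom_mat (?\<alpha> i) (- Q i)"
    proof (cases i)
      case (Suc j)
      then show ?thesis using homB[of j] by (simp add: Q_def hom_mat_def homogeneous_uminus)
    qed (simp add: Q_def hom_mat_def)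
  qed (use A[of i] Fc[of i] Q[of i] in simp_all)
  \<comment> \<open>As \<open>r 0 = 0\<close>, the matrix \<open>D 0\<close> is the single row
    consisting of \<open>A 0\<close> and \<open>g\<close>.\<close>
  have image: "(\<lambda>v. (D 0 *\<^sub>v v) $ 0) ` carrier_vec (p 1 + q 0) = {x + c * g | x c. x \<in> J}"
  proof -
    have D0: "(D 0 *\<^sub>v (z @\<^sub>v y)) $ 0 = (A 0 *\<^sub>v z) $ 0 + y $ 0 * g"
      if "z \<in> carrier_vec (p 1)" "y \<in> carrier_vec (q 0)" for z y
    proof -
      have y: "y \<in> carrier_vec 1" using that q0 by simp
      have "D 0 *\<^sub>v (z @\<^sub>v y) = (A 0 *\<^sub>v z + g1 *\<^sub>v y) @\<^sub>v (0\<^sub>m (r 0) (p (Suc 0)) *\<^sub>v z + - Q 0 *\<^sub>v y)"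
        unfolding D_def F0
        using that Q[of 0] g1 by (intro four_block_mat_mult_vec[OF A]) (simp_all add: uminus_carrier_mat)
      then show ?thesis
        using A[of 0] g1 p0 g1_mult[OF y] by (simp add: mult.commute)
    qed
    show ?thesis
    proof (intro subset_antisym subsetI)
      fix x assume "x \<in> (\<lambda>v. (D 0 *\<^sub>v v) $ 0) ` carrier_vec (p 1 + q 0)"
      then obtain v where v: "x = (D 0 *\<^sub>v v) $ 0" "v \<in> carrier_vec (p 1 + q 0)" by (rule imageE)
      have "x = (D 0 *\<^sub>v (vec_first v (p 1) @\<^sub>v vec_last v (q 0))) $ 0"
        unfolding v(1) vec_first_last_append[OF v(2)] ..
      also have "\<dots> = (A 0 *\<^sub>v vec_first v (p 1)) $ 0 + vec_last v (q 0) $ 0 * g"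
        by (rule D0) simp_all
      finally have "x = (A 0 *\<^sub>v vec_first v (p 1)) $ 0 + vec_last v (q 0) $ 0 * g" .
      moreover have "(A 0 *\<^sub>v vec_first v (p 1)) $ 0 \<in> J"
        unfolding imA[symmetric] by (rule imageI) simp
      ultimately show "x \<in> {x + c * g | x c. x \<in> J}" by blast
    next
      fix x assume "x \<in> {x + c * g | x c. x \<in> J}"
      then obtain x' c where x: "x = x' + c * g" "x' \<in> J" by blast
      obtain z where z: "x' = (A 0 *\<^sub>v z) $ 0" "z \<in> carrier_vec (p 1)"
        using x(2) unfolding imA[symmetric] by (rule imageE)
      have y: "vec 1 (\<lambda>_. c) \<in> carrier_vec (q 0)" by (simp add: q0)
      have "x = (D 0 *\<^sub>v (z @\<^sub>v vec 1 (\<lambda>_. c))) $ 0"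
        unfolding D0[OF z(2) y] x(1) z(1) by simp
      moreover have "z @\<^sub>v vec 1 (\<lambda>_. c) \<in> carrier_vec (p 1 + q 0)"
        using z(2) y by (rule append_carrier_vec)
      ultimately show "x \<in> (\<lambda>v. (D 0 *\<^sub>v v) $ 0) ` carrier_vec (p 1 + q 0)" by (rule image_eqI)
    qed
  qed
  have exact: "(\<lambda>v. D (Suc i) *\<^sub>v v) ` carrier_vec (p (Suc (Suc i)) + q (Suc i)) = mat_kernel (D i)" for i
  proof -
    have QB: "Q i *\<^sub>v (B i *\<^sub>v y) = 0\<^sub>v (r i)" if "y \<in> carrier_vec (q (Suc i))" for y
    proof (cases i)
      case 0
      then show ?thesis using Q[of i] r by (intro eq_vecI) simp_all
    next
      case (Suc j)
      then show ?thesis using BB[of y j] that by (simp add: Q_def r)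
    qed
    \<comment> \<open>For \<open>i = 0\<close> the equation says that \<open>g\<close> times the
      entry of \<open>y\<close> lies in \<open>J\<close>, so this entry lies in
      \<open>J : g\<close>, the image of \<open>B 0\<close>. For larger \<open>i\<close> it is
      exactness of \<open>B\<close>.\<close>
    have lift: "\<exists>x\<in>carrier_vec (q (Suc i)). B i *\<^sub>v x = y"
      if z: "z \<in> carrier_vec (p (Suc i))" and y: "y \<in> carrier_vec (q i)"
        and 1: "A i *\<^sub>v z + F i *\<^sub>v y = 0\<^sub>v (p i)" and 2: "Q i *\<^sub>v y = 0\<^sub>v (r i)" for z y
    proof (cases i)
      case 0
      have y': "y \<in> carrier_vec 1" using y 0 q0 by simp
      have "(A 0 *\<^sub>v z + g1 *\<^sub>v y) $ 0 = 0" using 1 p0 unfolding 0 F0 by simp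
      then have "(A 0 *\<^sub>v z) $ 0 + g * y $ 0 = 0"
        using g1 p0 A[of 0] g1_mult[OF y'] by simp
      then have "y $ 0 * g = - (A 0 *\<^sub>v z) $ 0"
        by (simp add: eq_neg_iff_add_eq_0 add.commute mult.commute)
      also have "\<dots> = (A 0 *\<^sub>v (- z)) $ 0"
        using mult_mat_vec_uminus[OF A, of z 0] z A[of 0] p0 unfolding 0 by simp
      finally have "y $ 0 * g \<in> J"
        unfolding imA[symmetric] using z 0 by (intro image_eqI[of _ _ "- z"]) simp_all
      then have "y $ 0 \<in> colon_ideal J g" by (simp add: colon_ideal_def)
      then obtain x where x: "y $ 0 = (B 0 *\<^sub>v x) $ 0" "x \<in> carrier_vec (q 1)"
        unfolding imB[symmetric] by (rule imageE)
      have "B 0 *\<^sub>v x = y"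
      proof (rule eq_vecI)
        fix k assume "k < dim_vec y"
        then have "k = 0" using y' by simp
        then show "(B 0 *\<^sub>v x) $ k = y $ k" using x(1) by simp
      qed (use B[of 0] y' q0 in simp)
      with x(2) show ?thesis unfolding 0 by (intro bexI[of _ x]) simp_all
    next
      case (Suc j)
      have "y \<in> mat_kernel (B j)"
        using y 2 unfolding Suc by (intro mat_kernelI[OF B]) (simp_all add: Q_def r)
      then have "y \<in> (\<lambda>v. B (Suc j) *\<^sub>v v) ` carrier_vec (q (Suc (Suc j)))" unfolding exB .
      then obtain x where "y = B (Suc j) *\<^sub>v x" "x \<in> carrier_vec (q (Suc (Suc j)))" by (rule imageE)
      then show ?thesis unfolding Suc by (intro bexI[of _ x]) simp_all
    qed
    have QS: "Q (Suc i) = B i" by (simp add: Q_def)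
    show ?thesis
      unfolding D_def QS r(2)
      by (rule mat_ker_im_cone[OF A A Q B Fc Fc comm exA]) (rule QB, assumption, rule lift)
  qed
  have "linear_res e (\<lambda>i. p i + r i) D {x + c * g | x c. x \<in> J}"
    unfolding linear_res_def
  proof (intro conjI allI)
    show "p 0 + r 0 = 1" by (simp add: p0 r)
    show "D i \<in> carrier_mat (p i + r i) (p (Suc i) + r (Suc i))" for i using Dc[of i] by (simp add: r)
    show "(\<lambda>v. (D 0 *\<^sub>v v) $ 0) ` carrier_vec (p 1 + r 1) = {x + c * g | x c. x \<in> J}"
      using image r(2)[of 0] by simp
    show "(\<lambda>v. D (Suc i) *\<^sub>v v) ` carrier_vec (p (Suc (Suc i)) + r (Suc (Suc i))) = mat_kernel (D i)" for i
      unfolding r(2) by (rule exact)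
  qed (rule homD)
  then show ?thesis by (intro exI)
qed

section \<open>From linear quotients to linear resolutions by iterated cones\<close>

lemma ideal_gen_insert:
  fixes g :: "'a::comm_ring_1"
  shows "ideal_gen (insert g S) = {x + c * g | x c. x \<in> ideal_gen S}"
proof -
  have "(\<exists>k. y - k * g \<in> ideal_gen S) \<longleftrightarrow> (\<exists>x c. y = x + c * g \<and> x \<in> ideal_gen S)" for y
  proof
    assume "\<exists>k. y - k * g \<in> ideal_gen S"
    then obtain k where "y - k * g \<in> ideal_gen S" ..
    then show "\<exists>x c. y = x + c * g \<and> x \<in> ideal_gen S"
      by (intro exI[of _ "y - k * g"] exI[of _ k]) simp
  next
    assume "\<exists>x c. y = x + c * g \<and> x \<in> ideal_gen S"
    then obtain x c where "y = x + c * g" "x \<in> ideal_gen S" by blast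
    then show "\<exists>k. y - k * g \<in> ideal_gen S" by (intro exI[of _ c]) simp
  qed
  then show ?thesis unfolding Modules.module.span_insert[OF module_ring] by simp
qed

lemma ideal_gen_empty: "ideal_gen {} = {0 :: 'a::comm_ring_1}"
  by (rule Modules.module.span_empty[OF module_ring])

text \<open>Multiplying by \<open>x_i\<close> changes no exponent at an index in \<open>V\<close>,
  and these exponents alone decide membership.\<close>

lemma colon_ideal_vars:
  fixes V :: "'n set"
  assumes "i \<notin> V"
  shows "colon_ideal (ideal_gen (var ` V)) (var i) = (ideal_gen (var ` V) :: ('n, 'k::comm_ring_1) mpoly set)"
proof (rule Set.set_eqI)
  fix p :: "('n, 'k) mpoly"
  have "(\<exists>j\<in>V. Poly_Mapping.lookup (t + Poly_Mapping.single i 1) j \<noteq> 0)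
    \<longleftrightarrow> (\<exists>j\<in>V. Poly_Mapping.lookup t j \<noteq> 0)" for t :: "'n exponent"
    using assms by (intro bex_cong refl) (auto simp: lookup_add lookup_single when_def)
  then show "p \<in> colon_ideal (ideal_gen (var ` V)) (var i) \<longleftrightarrow> p \<in> ideal_gen (var ` V)"
    unfolding in_ideal_gen_vars unfolding var_image var_def in_colon_ideal_monomial bex_simps(7)
      ex_eq_single_add_iff by simp
qed

text \<open>One resolution serves both for the ideal and for its colon ideal by the new variable.
  The ranks thus follow Pascal's rule, as in the Koszul complex.\<close>

lemma linear_res_vars:
  fixes V :: "'n::finite set"
  shows "\<exists>p A. linear_res 1 p A (ideal_gen (var ` V) :: ('n, 'k::comm_ring_1) mpoly set)"
  using finite[of V]
proof (induction rule: finite_induct)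
  case empty
  show ?case unfolding image_empty ideal_gen_empty by (rule linear_res_zero)
next
  case (insert i V)
  then obtain p A where pA: "linear_res 1 p A (ideal_gen (var ` V) :: ('n, 'k) mpoly set)" by blast
  have "homogeneous 1 (var i :: ('n, 'k) mpoly)"
    unfolding var_def using homogeneous_monomial[of "Poly_Mapping.single i 1"] unfolding mdeg_single .
  moreover have "linear_res 1 p A (colon_ideal (ideal_gen (var ` V)) (var i) :: ('n, 'k) mpoly set)"
    unfolding colon_ideal_vars[OF insert(2)] by (rule pA)
  ultimately show ?case
    unfolding image_insert ideal_gen_insert by (intro linear_res_add_generator[OF pA])
qed

lemma linear_quotients_imp_linear_resolution:
  fixes I :: "('n::finite, 'k::comm_ring_1) mpoly set"
  assumes lq: "has_linear_quotients I" and I: "ideal_gen (monomial ` min_gens I) = I"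
    and deg: "generated_in_degree e I"
  shows "has_linear_resolution I"
proof -
  obtain gs where gs: "set gs = min_gens I"
    and colon: "\<And>k. 1 \<le> k \<Longrightarrow> k < length gs \<Longrightarrow>
      \<exists>V. colon_ideal (ideal_gen (monomial ` set (take k gs))) (monomial (gs ! k))
        = (ideal_gen (var ` V) :: ('n, 'k) mpoly set)"
    using lq unfolding has_linear_quotients_def by blast
  have "\<exists>p A. linear_res e p A (ideal_gen (monomial ` set (take k gs)) :: ('n, 'k) mpoly set)"
    if "k \<le> length gs" for k
    using that
  proof (induction k)
    case 0
    show ?case unfolding take_0 list.set(1) image_empty ideal_gen_empty by (rule linear_res_zero)
  next
    case (Suc k)
    let ?J = "ideal_gen (monomial ` set (take k gs)) :: ('n, 'k) mpoly set"
    let ?g = "monomial (gs ! k) :: ('n, 'k) mpoly"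
    have k: "k < length gs" using Suc.prems by simp
    obtain p A where pA: "linear_res e p A ?J" using Suc by auto
    have "\<exists>V. colon_ideal ?J ?g = (ideal_gen (var ` V) :: ('n, 'k) mpoly set)"
    proof (cases "k = 0")
      \<comment> \<open>The definition of linear quotients starts at \<open>k = 1\<close>. Here the
        colon ideal of the zero ideal is generated by the empty set of variables.\<close>
      case True
      show ?thesis
        unfolding True take_0 list.set(1) by (rule exI, rule colon_ideal_eq_vars) simp
    next
      case False
      then show ?thesis using colon[of k] k by simp
    qed
    then obtain V where V: "colon_ideal ?J ?g = (ideal_gen (var ` V) :: ('n, 'k) mpoly set)" ..
    obtain q B where qB: "linear_res 1 q B (colon_ideal ?J ?g)"
      unfolding V using linear_res_vars[of V] by blast
    have "mdeg (gs ! k) = e" using deg gs nth_mem[OF k] unfolding generated_in_degree_def by simp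
    then have "homogeneous e ?g" using homogeneous_monomial[of "gs ! k"] by simp
    then show ?case
      unfolding take_Suc_conv_app_nth[OF k] set_append list.set Un_insert_right Un_empty_right
        image_insert ideal_gen_insert
      by (rule linear_res_add_generator[OF pA qB])
  qed
  from this[of "length gs"] obtain p A where "linear_res e p A I" unfolding take_all[OF le_refl] gs I by blast
  then show ?thesis by (rule linear_res_imp_has_linear_resolution)
qed

theorem theorem4p2:
  fixes I :: "('n::{finite,linorder}, 'k::field) mpoly set"
    and a :: "'n exponent"
    and d :: nat
  assumes "monomial_ideal I"
    and "determined a I"
    and "generated_in_degree d I"
    and "(stable_ideal I \<and> d = 2) \<or> strongly_stable_ideal I"
  shows "has_linear_quotients (dual_ideal a I) \<and> has_linear_resolution (dual_ideal a I)"
proof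
  show lq: "has_linear_quotients (dual_ideal a I)"
    using assms by (rule dual_has_linear_quotients)
  note dual = min_gens_dual[OF assms(1,2)]
  \<comment> \<open>Each \<open>m\<close> divides \<open>x^a\<close>, so degrees subtract and the
    dual is generated in the single degree \<open>mdeg a - d\<close>.\<close>
  have "mdeg (a - m) = mdeg a - d" if "m \<in> min_gens I" for m
  proof -
    obtain u where u: "a = m + u"
      using assms(2) \<open>m \<in> min_gens I\<close> unfolding determined_def monomial_dvd_iff by blast
    have "mdeg m = d" using assms(3) that unfolding generated_in_degree_def by simp
    then show ?thesis unfolding u by (simp add: mdeg_add)
  qed
  then have "generated_in_degree (mdeg a - d) (dual_ideal a I)"
    unfolding generated_in_degree_def dual by blast
  moreover have "ideal_gen (monomial ` min_gens (dual_ideal a I)) = dual_ideal a I"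
    unfolding dual unfolding dual_ideal_def ..
  ultimately show "has_linear_resolution (dual_ideal a I)"
    using lq by (intro linear_quotients_imp_linear_resolution)
qed

end
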